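(* Let $S_1[1..n_1]$ and $S_2[1..n_2]$ be strings over a totally ordered alphabet $\Sigma$. Suppose we are given an FM-index for $S_1$, i.e.\ a data structure answering rank queries $\mathrm{BWT}(S_1).\mathrm{rank}_a(i)$ together with the values $\sum_{a'\prec a} |S_1|_{a'}$ for every character $a$. Then one can store additional data structures occupying $O(\mathrm{BWD}(S_1,S_2))$ machine words such that, together with the FM-index of $S_1$, they form a (relative) FM-index for $S_2$ supporting counting queries (given a pattern $P$, determine the lexicographic range of suffixes of $S_2$ prefixed by $P$, and hence the number of occurrences of $P$ in $S_2$), where each counting query takes time at most an $O(\log \mathrm{BWD}(S_1,S_2))$ factor larger than the corresponding counting query on the FM-index of $S_1$.
   Context: Model: word RAM. For a string $S[1..n]$, the Burrows–Wheeler transform $\mathrm{BWT}(S)$ is the permutation of the characters of $S$ in which $S[i]$ comes before $S[j]$ iff the suffix $S[i+1..n]$ is lexicographically smaller than $S[j+1..n]$ (the suffix $S[n+1..n]$ is the empty string; a proper prefix is smaller than the longer string). For a string $X$, $X.\mathrm{rank}_a(i)$ is the number of occurrences of character $a$ in $X[1..i]$, and $|S|_{a}$ denotes the number of occurrences of $a$ in $S$. An FM-index of $S$ supports counting of a pattern $P[1..m]$ by $O(m)$ rank queries on $\mathrm{BWT}(S)$ via backward search: if the lexicographic range of suffixes starting with $\beta$ is $[i..j]$, the range for $a\beta$ is $[\mathrm{BWT}(S).\mathrm{rank}_a(i-1)+1+\sum_{a'\prec a}|S|_{a'} \,..\, \mathrm{BWT}(S).\mathrm{rank}_a(j)+\sum_{a'\prec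 a}|S|_{a'}]$. The BW-distance is $\mathrm{BWD}(S_1,S_2)=n_1+n_2-2\,|\mathrm{LCS}(\mathrm{BWT}(S_1),\mathrm{BWT}(S_2))|$, where LCS denotes a longest common subsequence. *)

theory Defs
  imports Complex_Main "HOL-Library.Sublist" "HOL-Library.List_Lexorder"
begin

text \<open>
  Strings are lists, hence indexed from 0. The order on lists is the lexicographic one of
  \<^theory>\<open>HOL-Library.List_Lexorder\<close>, in which a proper prefix is smaller.
\<close>

definition bwt :: "'a::linorder list \<Rightarrow> 'a list" where
  "bwt S = map (\<lambda>i. S ! i) (sort_key (\<lambda>i. drop (Suc i) S) [0..<length S])"

definition rank :: "'a \<Rightarrow> 'a list \<Rightarrow> nat \<Rightarrow> nat" where
  "rank a X i = count_list (take i X) a"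

definition smaller_count :: "'a::linorder list \<Rightarrow> 'a \<Rightarrow> nat" where
  "smaller_count S a = (\<Sum>a' | a' \<in> set S \<and> a' < a. count_list S a')"

definition lcs_length :: "'a list \<Rightarrow> 'a list \<Rightarrow> nat" where
  "lcs_length X Y = Max {length Z | Z. subseq Z X \<and> subseq Z Y}"

definition BWD :: "'a::linorder list \<Rightarrow> 'a list \<Rightarrow> nat" where
  "BWD S1 S2 = length S1 + length S2 - 2 * lcs_length (bwt S1) (bwt S2)"

definition sorted_suffixes :: "'a::linorder list \<Rightarrow> 'a list list" where
  "sorted_suffixes S = sort (map (\<lambda>k. drop k S) [0..<length S])"

text \<open>
  The nonempty suffixes are ranked from 1 to \<^term>\<open>length S\<close>. An empty range is
  represented by any pair \<open>l > r\<close>.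
\<close>

definition is_suffix_range :: "'a::linorder list \<Rightarrow> 'a list \<Rightarrow> nat \<Rightarrow> nat \<Rightarrow> bool" where
  "is_suffix_range S P l r \<longleftrightarrow>
     {l..r} = {k \<in> {1..length S}. prefix P (sorted_suffixes S ! (k - 1))}"

definition occurrences :: "'a list \<Rightarrow> 'a list \<Rightarrow> nat" where
  "occurrences P S = card {k. k < length S \<and> prefix P (drop k S)}"

text \<open>
  An FM-index as seen by a machine: characters are machine words, the query results are given by
  functions on words, and the last two components are the times taken by one query.
\<close>

record fm_index =
  fm_rank :: "nat \<Rightarrow> nat \<Rightarrow> nat"
  fm_smaller :: "nat \<Rightarrow> nat"
  rank_time :: nat
  smaller_time :: nat

definition is_fm_index ::
  "'a::linorder set \<Rightarrow> ('a \<Rightarrow> nat) \<Rightarrow> 'a list \<Rightarrow> fm_index \<Rightarrow> bool" where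
  "is_fm_index A code S I \<longleftrightarrow>
     (\<forall>a\<in>A. \<forall>i\<le>length S. fm_rank I (code a) i = rank a (bwt S) i) \<and>
     (\<forall>a\<in>A. fm_smaller I (code a) = smaller_count S a)"

text \<open>
  A word RAM with words \<open>0, \<dots>, 2 ^ w - 1\<close> and structured control flow. It has registers, a
  working memory, read-only access to an array of stored words and to the pattern, and it may
  query a given FM-index. All instructions and tests cost one unit, to which an FM-index query
  adds the time taken by the index.
\<close>

record env =
  width :: nat
  index :: fm_index
  stored :: "nat list"
  pattern :: "nat list"

record state =
  regs :: "nat \<Rightarrow> nat"
  mem :: "nat \<Rightarrow> nat"

type_synonym reg = nat

datatype binop = Add | Sub | Mul | Div | Mod | And | Or | Xor | Shl | Shr

datatype instr =
    Const reg nat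
  | Move reg reg
  | Op binop reg reg reg
  | Load reg reg
  | Store reg reg
  | Load_Stored reg reg
  | Load_Pattern reg reg
  | Query_Rank reg reg reg
  | Query_Smaller reg reg

datatype test = Eq reg reg | Neq reg reg | Lt reg reg | Le reg reg

datatype com =
    Instr instr
  | Seq com com (infixr \<open>;;\<close> 60)
  | Cond test com com
  | While test com

fun apply_op :: "nat \<Rightarrow> binop \<Rightarrow> nat \<Rightarrow> nat \<Rightarrow> nat" where
  "apply_op w Add x y = (x + y) mod 2 ^ w"
| "apply_op w Sub x y = (x + (2 ^ w - y)) mod 2 ^ w"
| "apply_op w Mul x y = (x * y) mod 2 ^ w"
| "apply_op w Div x y = x div y"
| "apply_op w Mod x y = x mod y"
| "apply_op w And x y = Bit_Operations.and x y"
| "apply_op w Or x y = Bit_Operations.or x y"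
| "apply_op w Xor x y = Bit_Operations.xor x y"
| "apply_op w Shl x y = push_bit y x mod 2 ^ w"
| "apply_op w Shr x y = drop_bit y x"

definition read :: "nat list \<Rightarrow> nat \<Rightarrow> nat" where
  "read xs k = (if k < length xs then xs ! k else 0)"

definition set_reg :: "state \<Rightarrow> reg \<Rightarrow> nat \<Rightarrow> state" where
  "set_reg s r x = s\<lparr>regs := (regs s)(r := x)\<rparr>"

fun step :: "env \<Rightarrow> instr \<Rightarrow> state \<Rightarrow> state" where
  "step E (Const r x) s = set_reg s r (x mod 2 ^ width E)"
| "step E (Move r a) s = set_reg s r (regs s a)"
| "step E (Op f r a b) s = set_reg s r (apply_op (width E) f (regs s a) (regs s b))"
| "step E (Load r a) s = set_reg s r (mem s (regs s a))"
| "step E (Store a r) s = s\<lparr>mem := (mem s)(regs s a := regs s r)\<rparr>"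
| "step E (Load_Stored r a) s = set_reg s r (read (stored E) (regs s a))"
| "step E (Load_Pattern r a) s = set_reg s r (read (pattern E) (regs s a))"
| "step E (Query_Rank r a i) s =
     set_reg s r (fm_rank (index E) (regs s a) (regs s i) mod 2 ^ width E)"
| "step E (Query_Smaller r a) s =
     set_reg s r (fm_smaller (index E) (regs s a) mod 2 ^ width E)"

fun cost :: "env \<Rightarrow> instr \<Rightarrow> nat" where
  "cost E (Query_Rank r a i) = 1 + rank_time (index E)"
| "cost E (Query_Smaller r a) = 1 + smaller_time (index E)"
| "cost E _ = 1"

fun holds :: "test \<Rightarrow> state \<Rightarrow> bool" where
  "holds (Eq a b) s \<longleftrightarrow> regs s a = regs s b"
| "holds (Neq a b) s \<longleftrightarrow> regs s a \<noteq> regs s b"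
| "holds (Lt a b) s \<longleftrightarrow> regs s a < regs s b"
| "holds (Le a b) s \<longleftrightarrow> regs s a \<le> regs s b"

text \<open>\<open>exec E c s t s'\<close>: started in \<open>s\<close>, the program \<open>c\<close> halts in \<open>s'\<close> after time \<open>t\<close>.\<close>

inductive exec :: "env \<Rightarrow> com \<Rightarrow> state \<Rightarrow> nat \<Rightarrow> state \<Rightarrow> bool" for E where
  exec_Instr: "exec E (Instr i) s (cost E i) (step E i s)"
| exec_Seq: "exec E c s t s' \<Longrightarrow> exec E d s' u s'' \<Longrightarrow> exec E (c ;; d) s (t + u) s''"
| exec_Cond_True: "holds b s \<Longrightarrow> exec E c s t s' \<Longrightarrow> exec E (Cond b c d) s (1 + t) s'"
| exec_Cond_False: "\<not> holds b s \<Longrightarrow> exec E d s t s' \<Longrightarrow> exec E (Cond b c d) s (1 + t) s'"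
| exec_While_False: "\<not> holds b s \<Longrightarrow> exec E (While b c) s 1 s"
| exec_While_True:
    "holds b s \<Longrightarrow> exec E c s t s' \<Longrightarrow> exec E (While b c) s' u s'' \<Longrightarrow>
     exec E (While b c) s (1 + t + u) s''"

lemma exec_deterministic:
  "exec E c s t s' \<Longrightarrow> exec E c s u s'' \<Longrightarrow> u = t \<and> s'' = s'"
proof (induction arbitrary: u s'' rule: exec.induct)
  case (exec_Instr i s)
  then show ?case by (auto elim: exec.cases)
next
  case (exec_Seq c s t s' d v s1)
  from exec_Seq.prems show ?case
    by (cases rule: exec.cases) (use exec_Seq.IH in blast)+
next
  case (exec_Cond_True b s c t s' d)
  from exec_Cond_True.prems show ?case
    by (cases rule: exec.cases) (use exec_Cond_True in blast)+
next
  case (exec_Cond_False b s d t s' c)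
  from exec_Cond_False.prems show ?case
    by (cases rule: exec.cases) (use exec_Cond_False in blast)+
next
  case (exec_While_False b s c)
  from exec_While_False.prems show ?case
    by (cases rule: exec.cases) (use exec_While_False in blast)+
next
  case (exec_While_True b s c t s' v s1)
  from exec_While_True.prems show ?case
    by (cases rule: exec.cases) (use exec_While_True in blast)+
qed

text \<open>The arguments of a query are passed in the registers 0, 1, \dots; all else is zero.\<close>

definition init :: "nat list \<Rightarrow> state" where
  "init xs = \<lparr>regs = read xs, mem = (\<lambda>_. 0)\<rparr>"

text \<open>
  Counting by backward search on an FM-index: with the pattern length as argument and the text
  length as the only stored word, each character \<open>a\<close> (in register 3), from the last to the first,
  turns the current range \<open>[i..j]\<close> (in registers 0 and 1) into
  \<open>[rank a (i - 1) + 1 + smaller a .. rank a j + smaller a]\<close>.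
\<close>

definition backward_search :: com where
  "backward_search =
     Instr (Move 2 0) ;;
     Instr (Const 4 1) ;;
     Instr (Const 5 0) ;;
     Instr (Move 0 4) ;;
     Instr (Load_Stored 1 5) ;;
     While (Lt 5 2)
       (Instr (Op Sub 2 2 4) ;;
        Instr (Load_Pattern 3 2) ;;
        Instr (Query_Smaller 6 3) ;;
        Instr (Op Sub 0 0 4) ;;
        Instr (Query_Rank 0 3 0) ;;
        Instr (Op Add 0 0 4) ;;
        Instr (Op Add 0 0 6) ;;
        Instr (Query_Rank 1 3 1) ;;
        Instr (Op Add 1 1 6))"

end

theory Submission
  imports Defs "HOL-Library.Multiset" "HOL-Library.Product_Lexorder"
begin

text \<open>
  A longest common subsequence turns \<open>bwt S1\<close> into \<open>bwt S2\<close> by \<open>BWD S1 S2\<close> events, each an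
  insertion (sign \<open>1\<close>) or a deletion (sign \<open>-1\<close>) placed at a position of \<open>bwt S2\<close>. If \<open>d\<close> is the
  sum of the signs of the events before position \<open>i\<close>, then the prefix of length \<open>i\<close> of \<open>bwt S2\<close>
  arises from the prefix of length \<open>i - d\<close> of \<open>bwt S1\<close>, so \<open>rank a (bwt S2) i\<close> is
  \<open>rank a (bwt S1) (i - d)\<close> plus the signs of the events with character \<open>a\<close> before \<open>i\<close>. Both
  corrections are prefix sums over the events sorted by position, respectively by character and
  position, hence found by binary search; events with smaller characters correct
  \<open>smaller_count\<close> in the same way.

  The transform has no end marker. Backward search is therefore run on the rows of all
  \<open>length S2 + 1\<close> suffixes, including the empty one, and the row of the whole text, which has no
  entry in the transform, is skipped when a row is translated into a position of \<open>bwt S2\<close>.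
\<close>

section \<open>Sorted lists\<close>

text \<open>Once a key falls outside the downward closed \<open>U\<close>, all later keys do, so
  filtering only cuts off the tail.\<close>

lemma sorted_take_filter:
  fixes f :: "'b \<Rightarrow> 'c::linorder"
  assumes "sorted (map f xs)" and "\<And>x y. x \<le> y \<Longrightarrow> U y \<Longrightarrow> U x"
  shows "take (length (filter (\<lambda>x. U (f x)) xs)) xs = filter (\<lambda>x. U (f x)) xs"
  using assms(1)
proof (induction xs)
  case (Cons x xs)
  show ?case
  proof (cases "U (f x)")
    case False
    then have "\<not> U (f y)" if "y \<in> set xs" for y
      using Cons.prems assms(2)[of "f x" "f y"] that by auto
    then have "filter (\<lambda>x. U (f x)) xs = []" by (simp add: filter_empty_conv)
    then show ?thesis using False by simp
  qed (use Cons in simp)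
qed simp

text \<open>Membership in a down-set becomes a comparison of indices; this turns suffix ranges into
  intervals and gives binary search its threshold.\<close>

lemma sorted_nth_iff_less_length_filter:
  fixes f :: "'b \<Rightarrow> 'c::linorder"
  assumes "sorted (map f xs)" and "\<And>x y. x \<le> y \<Longrightarrow> U y \<Longrightarrow> U x" and "j < length xs"
  shows "U (f (xs ! j)) \<longleftrightarrow> j < length (filter (\<lambda>x. U (f x)) xs)"
  using assms(1,3)
proof (induction xs arbitrary: j)
  case (Cons x xs)
  show ?case
  proof (cases "U (f x)")
    case True
    then show ?thesis using Cons by (cases j) auto
  next
    case False
    then have "\<not> U (f y)" if "y \<in> set (x # xs)" for y
      using Cons.prems(1) assms(2)[of "f x" "f y"] that by auto
    then have "filter (\<lambda>x. U (f x)) (x # xs) = []" "\<not> U (f ((x # xs) ! j))"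
      using Cons.prems(2) by (auto simp only: filter_empty_conv nth_mem)
    then show ?thesis by simp
  qed
qed simp

section \<open>Backward search\<close>

lemma mset_bwt: "mset (bwt S) = mset S"
proof -
  have "mset (bwt S) = mset (map ((!) S) [0..<length S])"
    by (simp add: bwt_def)
  then show ?thesis by (simp add: map_nth)
qed

lemma set_bwt: "set (bwt S) = set S"
  using mset_bwt[of S] by (metis set_mset_mset)

lemma length_bwt: "length (bwt S) = length S"
  by (simp add: bwt_def)

lemma smaller_count_eq_filter: "smaller_count S a = length (filter (\<lambda>x. x < a) S)"
proof -
  have "length (filter (\<lambda>x. x < a) S) = (\<Sum>b\<in>set (filter (\<lambda>x. x < a) S). count_list (filter (\<lambda>x. x < a) S) b)"
    using sum_count_set[of "filter (\<lambda>x. x < a) S"] by simp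
  also have "\<dots> = smaller_count S a"
    unfolding smaller_count_def
  proof (rule sum.cong)
    fix b assume "b \<in> {a' \<in> set S. a' < a}"
    then have "b < a" by simp
    then show "count_list (filter (\<lambda>x. x < a) S) b = count_list S b"
      by (induction S) auto
  qed auto
  finally show ?thesis by simp
qed

lemma smaller_count_bwt: "smaller_count S a = length (filter (\<lambda>x. x < a) (bwt S))"
  by (metis mset_bwt mset_filter size_mset smaller_count_eq_filter)

section \<open>Rows of the sorted suffixes and one step of backward search\<close>

lemma length_filter_upt: "length (filter Q [0..<n]) = card {i. i < n \<and> Q i}"
  unfolding length_filter_conv_card by (rule arg_cong[where f = card]) auto

lemma count_list_map_filter:
  "count_list (map g (filter Q xs)) a = length (filter (\<lambda>i. g i = a \<and> Q i) xs)"
  by (induction xs) auto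

text \<open>Meant for downward closed \<open>U\<close>: the suffixes in \<open>U\<close> are then
  the first rows in sorted order, and the count marks the boundary behind them.\<close>

definition row_count :: "'a list \<Rightarrow> ('a list \<Rightarrow> bool) \<Rightarrow> nat" where
  "row_count S U = card {k. k \<le> length S \<and> U (drop k S)}"

text \<open>The 0-based row of the whole text, so for a down-set \<open>U\<close> the test
  \<open>text_row S < row_count S U\<close> asks whether that row lies before the boundary.\<close>

definition text_row :: "'a::linorder list \<Rightarrow> nat" where
  "text_row S = row_count S (\<lambda>y. y < S)"

definition prepend_set :: "'a::linorder \<Rightarrow> ('a list \<Rightarrow> bool) \<Rightarrow> 'a list \<Rightarrow> bool" where
  "prepend_set a U y \<longleftrightarrow> y = [] \<or> hd y < a \<or> hd y = a \<and> U (tl y)"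

text \<open>\<open>below P\<close> and \<open>upto_prefixed P\<close> are the down-sets that end
  just before and just after the strings with prefix \<open>P\<close>; they stand for the two ends
  of a range.\<close>

definition below :: "'a::linorder list \<Rightarrow> 'a list \<Rightarrow> bool" where
  "below P y \<longleftrightarrow> y < P"

definition upto_prefixed :: "'a::linorder list \<Rightarrow> 'a list \<Rightarrow> bool" where
  "upto_prefixed P y \<longleftrightarrow> y < P \<or> prefix P y"

lemma below_Cons: "below (a # P) = prepend_set a (below P)"
proof
  fix y show "below (a # P) y = prepend_set a (below P) y"
    by (cases y) (auto simp: below_def prepend_set_def)
qed

lemma upto_prefixed_Cons: "upto_prefixed (a # P) = prepend_set a (upto_prefixed P)"
proof
  fix y show "upto_prefixed (a # P) y = prepend_set a (upto_prefixed P) y"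
    by (cases y) (auto simp: upto_prefixed_def prepend_set_def)
qed

lemma below_down: "x \<le> y \<Longrightarrow> below P y \<Longrightarrow> below P x"
  by (simp add: below_def)

lemma upto_prefixed_down: "x \<le> y \<Longrightarrow> upto_prefixed P y \<Longrightarrow> upto_prefixed P x"
proof (induction P arbitrary: x y)
  case (Cons a P)
  then show ?case
    by (cases x; cases y) (auto simp: upto_prefixed_def)
qed (simp add: upto_prefixed_def)

text \<open>For \<open>k > 0\<close> the row \<open>drop k S\<close> belongs to the entry
  \<open>S ! (k - 1)\<close> of the transform; only \<open>k = 0\<close> has none. As
  \<open>U\<close> is downward closed, the row of the text lies before the boundary exactly if
  \<open>U S\<close> holds.\<close>

lemma row_count_skip_text:
  assumes "\<And>x y. x \<le> y \<Longrightarrow> U y \<Longrightarrow> U x"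
  shows "(if text_row S < row_count S U then row_count S U - 1 else row_count S U)
    = card {i. i < length S \<and> U (drop (Suc i) S)}"
proof -
  let ?R = "{k. k \<le> length S \<and> U (drop k S)}"
  let ?T = "{k. k \<le> length S \<and> drop k S < S}"
  let ?C = "{i. i < length S \<and> U (drop (Suc i) S)}"
  have img: "Suc ` ?C = ?R - {0}"
  proof
    show "?R - {0} \<subseteq> Suc ` ?C"
    proof
      fix k assume "k \<in> ?R - {0}"
      then show "k \<in> Suc ` ?C" by (cases k) auto
    qed
  qed auto
  have c: "card ?C = card (?R - {0})"
    unfolding img[symmetric] by (rule card_image[symmetric]) simp
  have fin: "finite ?R" "finite ?T" by auto
  show ?thesis
  proof (cases "U S")
    case True
    have "insert 0 ?T \<subseteq> ?R"
    proof
      fix k assume "k \<in> insert 0 ?T"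
      then show "k \<in> ?R" using True assms[of "drop k S" S] by auto
    qed
    then have "card (insert 0 ?T) \<le> card ?R" by (rule card_mono[OF fin(1)])
    then have "text_row S < row_count S U"
      using fin by (simp add: text_row_def row_count_def)
    moreover have "0 \<in> ?R" using True by simp
    ultimately show ?thesis using c fin by (simp add: row_count_def)
  next
    case False
    have "?R \<subseteq> ?T"
    proof
      fix k assume "k \<in> ?R"
      then show "k \<in> ?T" using False assms[of S "drop k S"] leI by auto
    qed
    then have "card ?R \<le> card ?T" by (rule card_mono[OF fin(2)])
    moreover have "?R - {0} = ?R" using False by auto
    ultimately show ?thesis using c by (simp add: row_count_def text_row_def)
  qed
qed

text \<open>\<open>bwt\<close> sorts positions by the suffix that follows, so positions whose
  following suffix lies in a down-set come first.\<close>

lemma rank_bwt_row_count: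
  assumes "\<And>x y. x \<le> y \<Longrightarrow> U y \<Longrightarrow> U x"
  shows "rank a (bwt S) (card {i. i < length S \<and> U (drop (Suc i) S)})
    = card {i. i < length S \<and> S ! i = a \<and> U (drop (Suc i) S)}"
proof -
  let ?f = "\<lambda>i. drop (Suc i) S"
  let ?xs = "sort_key ?f [0..<length S]"
  have m: "mset ?xs = mset [0..<length S]" by simp
  have len: "length (filter Q ?xs) = card {i. i < length S \<and> Q i}" for Q
    by (metis length_filter_upt m mset_filter size_mset)
  have "take (card {i. i < length S \<and> U (?f i)}) ?xs = filter (\<lambda>i. U (?f i)) ?xs"
    using sorted_take_filter[of ?f ?xs U, OF sorted_sort_key assms]
    by (simp only: len)
  then have "rank a (bwt S) (card {i. i < length S \<and> U (?f i)})
    = count_list (map ((!) S) (filter (\<lambda>i. U (?f i)) ?xs)) a"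
    by (simp add: rank_def bwt_def take_map)
  also have "\<dots> = length (filter (\<lambda>i. S ! i = a \<and> U (?f i)) ?xs)"
    by (rule count_list_map_filter)
  finally show ?thesis by (simp only: len)
qed

text \<open>The suffixes in the new down-set are the empty one, those with a smaller first
  character, and those that start with \<open>a\<close> and continue in \<open>U\<close>. The last
  kind is counted by a rank query once the row of the text is skipped.\<close>

lemma row_count_prepend:
  assumes "\<And>x y. x \<le> y \<Longrightarrow> U y \<Longrightarrow> U x"
  shows "row_count S (prepend_set a U) = 1 + smaller_count S a
    + rank a (bwt S) (if text_row S < row_count S U then row_count S U - 1 else row_count S U)"
proof -
  let ?n = "length S"
  let ?L = "{k. k < ?n \<and> S ! k < a}"
  let ?E = "{k. k < ?n \<and> S ! k = a \<and> U (drop (Suc k) S)}"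
  have "prepend_set a U (drop k S) \<longleftrightarrow> k \<in> insert ?n (?L \<union> ?E)" if "k \<le> ?n" for k
  proof (cases "k = ?n")
    case False
    then have "k < ?n" using that by simp
    then have "drop k S = S ! k # drop (Suc k) S" by (rule Cons_nth_drop_Suc[symmetric])
    then show ?thesis using \<open>k < ?n\<close> by (simp add: prepend_set_def)
  qed (simp add: prepend_set_def)
  then have "{k. k \<le> ?n \<and> prepend_set a U (drop k S)} = insert ?n (?L \<union> ?E)" by auto
  then have "row_count S (prepend_set a U) = 1 + card (?L \<union> ?E)"
    by (simp add: row_count_def)
  also have "card (?L \<union> ?E) = card ?L + card ?E"
    by (rule card_Un_disjoint) auto
  also have "card ?L = smaller_count S a"
    by (simp add: smaller_count_eq_filter length_filter_conv_card)
  also have "card ?E = rank a (bwt S)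
      (if text_row S < row_count S U then row_count S U - 1 else row_count S U)"
    by (simp only: row_count_skip_text[of U, OF assms] rank_bwt_row_count[of U, OF assms])
  finally show ?thesis by simp
qed

lemma row_count_le: "row_count S U \<le> Suc (length S)"
proof -
  have "card {k. k \<le> length S \<and> U (drop k S)} \<le> card {..length S}"
    by (rule card_mono) auto
  then show ?thesis by (simp add: row_count_def)
qed

lemma row_count_Nil [simp]:
  "row_count S (below []) = 0" "row_count S (upto_prefixed []) = Suc (length S)"
proof -
  have "{k. k \<le> length S} = {..length S}" by auto
  then show "row_count S (upto_prefixed []) = Suc (length S)"
    by (simp add: row_count_def upto_prefixed_def)
qed (simp add: row_count_def below_def)

section \<open>From row counts to ranges of nonempty suffixes\<close>

lemma row_count_eq:
  "row_count S U = (if U [] then 1 else 0) + card {k. k < length S \<and> U (drop k S)}"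
proof -
  let ?R = "{k. k \<le> length S \<and> U (drop k S)}" and ?C = "{k. k < length S \<and> U (drop k S)}"
  have "?R = (if U [] then insert (length S) ?C else ?C)"
    using le_less[of _ "length S"] by auto
  then show ?thesis by (simp add: row_count_def)
qed

lemma prefix_not_less:
  fixes P y :: "'a::linorder list"
  shows "prefix P y \<Longrightarrow> \<not> y < P"
proof (induction P arbitrary: y)
  case (Cons a P)
  then show ?case by (cases y) auto
qed simp

text \<open>Ranks ignore the empty suffix. \<open>hi\<close> always includes it and is one too large
  as a right end; \<open>lo\<close> includes it for nonempty \<open>P\<close> and is thereby already
  the 1-based left end. Since \<open>below []\<close> is empty, \<open>lo\<close> is 0 there and is
  raised to 1.\<close>

lemma suffix_range_row_counts:
  defines "lo \<equiv> \<lambda>S P. row_count S (below P)"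
    and "hi \<equiv> \<lambda>S P. row_count S (upto_prefixed P)"
  shows "is_suffix_range S P (if lo S P < 1 then 1 else lo S P) (hi S P - 1)" (is ?range)
    and "hi S P - 1 + 1 - (if lo S P < 1 then 1 else lo S P) = occurrences P S" (is ?occ)
    and "1 \<le> hi S P"
proof -
  let ?ss = "sorted_suffixes S"
  define c where "c U = card {k. k < length S \<and> U (drop k S)}" for U
  have len: "length (filter U ?ss) = c U" for U
  proof -
    have "mset (filter U ?ss) = mset (filter U (map (\<lambda>k. drop k S) [0..<length S]))"
      by (simp add: sorted_suffixes_def mset_filter)
    then have "length (filter U ?ss) = length (filter U (map (\<lambda>k. drop k S) [0..<length S]))"
      by (metis size_mset)
    also have "\<dots> = c U"
      by (simp add: c_def filter_map o_def length_filter_upt)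
    finally show ?thesis .
  qed
  have nth: "U (?ss ! j) \<longleftrightarrow> j < c U"
    if "\<And>x y. x \<le> y \<Longrightarrow> U y \<Longrightarrow> U x" "j < length S" for U j
  proof -
    have "sorted (map (\<lambda>x. x) ?ss)" "j < length ?ss"
      using that(2) by (simp_all add: sorted_suffixes_def)
    from sorted_nth_iff_less_length_filter[OF this(1) that(1) this(2)] show ?thesis
      by (simp only: len)
  qed
  have pre: "prefix P y \<longleftrightarrow> upto_prefixed P y \<and> \<not> below P y" for y
    using prefix_not_less[of P y] by (auto simp: upto_prefixed_def below_def)
  show 1: "1 \<le> hi S P"
    by (cases P) (auto simp: hi_def row_count_eq upto_prefixed_def)
  have l: "(if lo S P < 1 then 1 else lo S P) = c (below P) + 1"
    by (cases P) (simp_all add: lo_def row_count_eq c_def below_def)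
  have h: "hi S P - 1 = c (upto_prefixed P)"
    by (cases P) (simp_all add: hi_def row_count_eq c_def upto_prefixed_def)
  have cle: "c (upto_prefixed P) \<le> length S"
    using length_filter_le[of "upto_prefixed P" ?ss] unfolding len
    by (simp add: sorted_suffixes_def)
  have nthl: "below P (?ss ! j) \<longleftrightarrow> j < c (below P)"
    and nthh: "upto_prefixed P (?ss ! j) \<longleftrightarrow> j < c (upto_prefixed P)" if "j < length S" for j
    by (rule nth[OF _ that], erule (1) below_down)
       (rule nth[OF _ that], erule (1) upto_prefixed_down)
  show ?range
    unfolding is_suffix_range_def l h
  proof (intro set_eqI iffI)
    fix k assume "k \<in> {c (below P) + 1..c (upto_prefixed P)}"
    then show "k \<in> {k \<in> {1..length S}. prefix P (?ss ! (k - 1))}"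
      using nthl[of "k - 1"] nthh[of "k - 1"] cle by (simp add: pre) linarith
  next
    fix k assume "k \<in> {k \<in> {1..length S}. prefix P (?ss ! (k - 1))}"
    then show "k \<in> {c (below P) + 1..c (upto_prefixed P)}"
      using nthl[of "k - 1"] nthh[of "k - 1"] by (cases k) (auto simp: pre)
  qed
  have "occurrences P S = card ({k. k < length S \<and> upto_prefixed P (drop k S)}
      - {k. k < length S \<and> below P (drop k S)})"
    unfolding occurrences_def pre by (rule arg_cong[where f = card]) auto
  also have "\<dots> = c (upto_prefixed P) - c (below P)"
    unfolding c_def by (rule card_Diff_subset) (auto simp: upto_prefixed_def below_def)
  finally show ?occ unfolding l h by simp
qed

section \<open>Edit scripts\<close>

datatype 'a edit = Keep 'a | Del 'a | Ins 'a

fun source :: "'a edit list \<Rightarrow> 'a list" where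
  "source [] = []"
| "source (Keep c # es) = c # source es"
| "source (Del c # es) = c # source es"
| "source (Ins c # es) = source es"

fun target :: "'a edit list \<Rightarrow> 'a list" where
  "target [] = []"
| "target (Keep c # es) = c # target es"
| "target (Del c # es) = target es"
| "target (Ins c # es) = c # target es"

text \<open>
  An event records the number of target characters before it (in addition to \<open>q\<close>), the character,
  and \<open>1\<close> for an insertion or \<open>-1\<close> for a deletion.
\<close>

fun events :: "nat \<Rightarrow> 'a edit list \<Rightarrow> (nat \<times> 'a \<times> int) list" where
  "events q [] = []"
| "events q (Keep c # es) = events (Suc q) es"
| "events q (Del c # es) = (q, c, -1) # events q es"
| "events q (Ins c # es) = (q, c, 1) # events (Suc q) es"

definition balance :: "(nat \<Rightarrow> 'a \<Rightarrow> bool) \<Rightarrow> (nat \<times> 'a \<times> int) list \<Rightarrow> int" where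
  "balance Q evs = (\<Sum>(p, c, s)\<leftarrow>evs. if Q p c then s else 0)"

lemma balance_simps [simp]:
  "balance Q [] = 0"
  "balance Q ((p, c, s) # evs) = (if Q p c then s else 0) + balance Q evs"
  by (simp_all add: balance_def)

lemma balance_cong:
  "(\<And>p c s. (p, c, s) \<in> set evs \<Longrightarrow> Q p c \<longleftrightarrow> Q' p c) \<Longrightarrow> balance Q evs = balance Q' evs"
  unfolding balance_def by (rule arg_cong[where f = sum_list], rule map_cong) auto

lemma source_append [simp]: "source (es @ fs) = source es @ source fs"
  by (induction es rule: source.induct) auto

lemma target_append [simp]: "target (es @ fs) = target es @ target fs"
  by (induction es rule: target.induct) auto

lemma length_events: "length (events q es) = length (filter (\<lambda>e. \<forall>c. e \<noteq> Keep c) es)"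
  by (induction q es rule: events.induct) auto

lemma map_Del [simp]:
  "source (map Del xs) = xs" "target (map Del xs) = []" "length (filter (\<lambda>e. \<forall>c. e \<noteq> Keep c) (map Del xs)) = length xs"
  by (induction xs) auto

lemma map_Ins [simp]:
  "source (map Ins xs) = []" "target (map Ins xs) = xs" "length (filter (\<lambda>e. \<forall>c. e \<noteq> Keep c) (map Ins xs)) = length xs"
  by (induction xs) auto

text \<open>Characters matched by \<open>Z\<close> are kept, the others of \<open>X\<close> deleted
  and the others of \<open>Y\<close> inserted. So each character of \<open>X\<close> or
  \<open>Y\<close> is either one event or one of the two copies of a kept character.\<close>

lemma common_subseq_edit_script:
  assumes "subseq Z X" and "subseq Z Y"
  shows "\<exists>es. source es = X \<and> target es = Y \<and>
    length (events 0 es) + 2 * length Z = length X + length Y"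
  using assms
proof (induction arbitrary: Y rule: list_emb.induct)
  case (list_emb_Nil X)
  show ?case
    by (rule exI[of _ "map Del X @ map Ins Y"]) (simp add: length_events)
next
  case (list_emb_Cons Z X x)
  then obtain es where "source es = X" "target es = Y"
    "length (events 0 es) + 2 * length Z = length X + length Y" by blast
  then show ?case by (intro exI[of _ "Del x # es"]) (simp add: length_events)
next
  case (list_emb_Cons2 x x' Z X)
  \<comment> \<open>A match of \<open>x\<close> splits \<open>Y\<close>; the part \<open>us\<close>
    before it becomes insertions.\<close>
  from list_emb_ConsD[OF list_emb_Cons2.prems]
  obtain us vs where Y: "Y = us @ x # vs" "subseq Z vs" by auto
  obtain es where es: "source es = X" "target es = vs"
    "length (events 0 es) + 2 * length Z = length X + length vs"
    using list_emb_Cons2.IH[OF Y(2)] by blast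
  show ?case
    using es Y list_emb_Cons2.hyps
    by (intro exI[of _ "map Ins us @ Keep x # es"])
       (simp add: length_events)
qed

lemma events_pos_ge: "(p, c, s) \<in> set (events q es) \<Longrightarrow> q \<le> p"
  by (induction q es rule: events.induct) (auto dest: Suc_leD)

lemma events_bounds:
  "(p, c, s) \<in> set (events q es) \<Longrightarrow> p \<le> q + length (target es) \<and> c \<in> set (source es) \<union> set (target es)"
  by (induction q es rule: events.induct) auto

text \<open>Kept characters count on both sides, so only events change the count. Taking
  \<open>Q\<close> as being smaller than \<open>a\<close> yields the correction of
  \<open>smaller_count\<close>.\<close>

lemma balance_total:
  "int (length (filter Q (target es))) =
     int (length (filter Q (source es))) + balance (\<lambda>_. Q) (events q es)"
  by (induction q es rule: events.induct) auto

lemma balance_events_before: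
  assumes "\<And>p c. Q p c \<Longrightarrow> p < q"
  shows "balance Q (events q es) = 0"
proof -
  have "balance Q (events q es) = balance (\<lambda>_ _. False) (events q es)"
  proof (rule balance_cong)
    fix p c s assume "(p, c, s) \<in> set (events q es)"
    then have "q \<le> p" by (rule events_pos_ge)
    then show "Q p c \<longleftrightarrow> False" using assms[of p c] by auto
  qed
  then show ?thesis by (simp add: balance_def split_def)
qed

text \<open>
  The shortest prefix of the script that produces \<open>i\<close> target characters contains exactly the events
  before position \<open>q + i\<close>.
\<close>

lemma rank_target:
  fixes q i :: nat and es :: "'a edit list"
  defines "d \<equiv> balance (\<lambda>p _. p < q + i) (events q es)"
  assumes "i \<le> length (target es)"
  shows "0 \<le> int i - d \<and> int i - d \<le> int (length (source es)) \<and>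
    int (rank a (target es) i) = int (rank a (source es) (nat (int i - d))) +
      balance (\<lambda>p c. c = a \<and> p < q + i) (events q es)"
  using assms(2) unfolding d_def
proof (induction q es arbitrary: i rule: events.induct)
  case (1 q)
  then show ?case by (simp add: rank_def)
next
  case (2 q c es)
  show ?case
  proof (cases i)
    case 0
    then show ?thesis
      using balance_events_before[of "\<lambda>p _. p < q" q "Keep c # es"]
        balance_events_before[of "\<lambda>p c. c = a \<and> p < q" q "Keep c # es"]
      by (simp add: rank_def)
  next
    case (Suc j)
    define d where "d = balance (\<lambda>p _. p < Suc q + j) (events (Suc q) es)"
    note IH = 2(1)[of j, folded d_def]
    have "nat (int i - d) = Suc (nat (int j - d))" using IH 2(2) Suc by force
    moreover have "balance (\<lambda>p _. p < q + i) (events q (Keep c # es)) = d"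
      by (simp add: d_def Suc)
    ultimately show ?thesis using IH 2(2) Suc by (simp add: rank_def)
  qed
next
  case (3 q c es)
  show ?case
  proof (cases i)
    \<comment> \<open>A deletion at position \<open>q\<close> is not before \<open>q\<close>, so at
      \<open>i = 0\<close> no event counts and both prefixes are empty.\<close>
    case 0
    then show ?thesis
      using balance_events_before[of "\<lambda>p _. p < q" q "Del c # es"]
        balance_events_before[of "\<lambda>p c. c = a \<and> p < q" q "Del c # es"]
      by (simp add: rank_def)
  next
    case (Suc j)
    define d where "d = balance (\<lambda>p _. p < q + i) (events q es)"
    note IH = 3(1)[of i, folded d_def]
    \<comment> \<open>A deletion consumes a source character but no target character:
      \<open>i\<close> and \<open>q\<close> stay, and the source prefix grows by one.\<close>
    have "nat (int i - (d - 1)) = Suc (nat (int i - d))" using IH 3(2) by force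
    moreover have "balance (\<lambda>p _. p < q + i) (events q (Del c # es)) = d - 1"
      by (simp add: d_def Suc)
    ultimately show ?thesis using IH 3(2) Suc by (simp add: rank_def)
  qed
next
  case (4 q c es)
  show ?case
  proof (cases i)
    case 0
    then show ?thesis
      using balance_events_before[of "\<lambda>p _. p < q" q "Ins c # es"]
        balance_events_before[of "\<lambda>p c. c = a \<and> p < q" q "Ins c # es"]
      by (simp add: rank_def)
  next
    case (Suc j)
    define d where "d = balance (\<lambda>p _. p < Suc q + j) (events (Suc q) es)"
    note IH = 4(1)[of j, folded d_def]
    have "nat (int i - (d + 1)) = nat (int j - d)" using Suc by simp
    moreover have "balance (\<lambda>p _. p < q + i) (events q (Ins c # es)) = d + 1"
      by (simp add: d_def Suc)
    ultimately show ?thesis using IH 4(2) Suc by (simp add: rank_def)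
  qed
qed

text \<open>The lengths of common subsequences form a finite nonempty set, so the maximum is
  attained by some \<open>Z\<close>. Its script also shows that the natural subtraction in
  \<open>BWD\<close> does not truncate.\<close>

lemma BWD_edit_script:
  "\<exists>es. source es = bwt S1 \<and> target es = bwt S2 \<and> length (events 0 es) = BWD S1 S2"
proof -
  let ?M = "{length Z | Z. subseq Z (bwt S1) \<and> subseq Z (bwt S2)}"
  have "?M \<subseteq> {..length S1}"
    by (auto dest!: list_emb_length simp: length_bwt)
  then have "finite ?M" by (rule finite_subset) simp
  moreover have "0 \<in> ?M" by (auto intro!: exI[of _ "[]"])
  ultimately have "lcs_length (bwt S1) (bwt S2) \<in> ?M"
    unfolding lcs_length_def by (intro Max_in) auto
  then obtain Z where "subseq Z (bwt S1)" "subseq Z (bwt S2)"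
    "lcs_length (bwt S1) (bwt S2) = length Z" by auto
  moreover from this obtain es where "source es = bwt S1" "target es = bwt S2"
    "length (events 0 es) + 2 * length Z = length (bwt S1) + length (bwt S2)"
    using common_subseq_edit_script by blast
  ultimately show ?thesis by (intro exI[of _ es]) (simp add: BWD_def length_bwt)
qed

section \<open>Running programs\<close>

text \<open>A weakest precondition for termination that exposes the time to \<open>Q\<close>; its
  equations let the simplifier run programs symbolically and add up costs.\<close>

definition wp :: "env \<Rightarrow> com \<Rightarrow> (nat \<Rightarrow> state \<Rightarrow> bool) \<Rightarrow> state \<Rightarrow> bool" where
  "wp E c Q s \<longleftrightarrow> (\<exists>t s'. exec E c s t s' \<and> Q t s')"

inductive_cases exec_InstrE: "exec E (Instr i) s t s'"
inductive_cases exec_SeqE: "exec E (c ;; d) s t s'"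
inductive_cases exec_CondE: "exec E (Cond b c d) s t s'"

lemma wp_Instr [simp]: "wp E (Instr i) Q s \<longleftrightarrow> Q (cost E i) (step E i s)"
  by (auto simp: wp_def intro: exec_Instr elim: exec_InstrE)

lemma wp_Seq [simp]: "wp E (c ;; d) Q s \<longleftrightarrow> wp E c (\<lambda>t. wp E d (\<lambda>u. Q (t + u))) s"
  unfolding wp_def by (blast elim: exec_SeqE intro: exec_Seq)

lemma wp_Cond [simp]:
  "wp E (Cond b c d) Q s \<longleftrightarrow>
     (if holds b s then wp E c (\<lambda>t. Q (1 + t)) s else wp E d (\<lambda>t. Q (1 + t)) s)"
proof (cases "holds b s")
  case True
  then have "exec E (Cond b c d) s t s' \<longleftrightarrow> (\<exists>u. t = 1 + u \<and> exec E c s u s')" for t s'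
    by (auto intro: exec_Cond_True[simplified] elim!: exec_CondE)
  then show ?thesis using True by (auto simp: wp_def)
next
  case False
  then have "exec E (Cond b c d) s t s' \<longleftrightarrow> (\<exists>u. t = 1 + u \<and> exec E d s u s')" for t s'
    by (auto intro: exec_Cond_False[simplified] elim!: exec_CondE)
  then show ?thesis using False by (auto simp: wp_def)
qed

lemma wp_While_False: "\<not> holds b s \<Longrightarrow> Q 1 s \<Longrightarrow> wp E (While b c) Q s"
  unfolding wp_def by (blast intro: exec_While_False)

lemma wp_While_True:
  "holds b s \<Longrightarrow> wp E c (\<lambda>t. wp E (While b c) (\<lambda>u. Q (1 + t + u))) s \<Longrightarrow> wp E (While b c) Q s"
  unfolding wp_def by (blast intro: exec_While_True)

lemma regs_set_reg [simp]: "regs (set_reg s r x) r' = (if r' = r then x else regs s r')"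
  by (simp add: set_reg_def)

section \<open>Integers as machine words modulo \<open>2 ^ w\<close>\<close>

definition to_word :: "nat \<Rightarrow> int \<Rightarrow> nat" where
  "to_word w z = nat (z mod 2 ^ w)"

lemma int_to_word: "int (to_word w z) = z mod 2 ^ w"
  by (simp add: to_word_def)

lemma to_word_less: "to_word w z < 2 ^ w"
proof -
  have "int (to_word w z) < int (2 ^ w)" by (simp add: int_to_word)
  then show ?thesis by (simp only: of_nat_less_iff)
qed

lemma to_word_int: "n < 2 ^ w \<Longrightarrow> to_word w (int n) = n"
proof -
  assume "n < 2 ^ w"
  then have "int n < int (2 ^ w)" by (simp only: of_nat_less_iff)
  then show ?thesis by (simp add: to_word_def)
qed

lemma add_to_word: "(to_word w y + to_word w z) mod 2 ^ w = to_word w (y + z)"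
proof -
  have "int ((to_word w y + to_word w z) mod 2 ^ w) = int (to_word w (y + z))"
    by (simp add: int_to_word zmod_int mod_simps)
  then show ?thesis by (simp only: of_nat_eq_iff)
qed

lemma diff_to_word: "(to_word w y + (2 ^ w - to_word w z)) mod 2 ^ w = to_word w (y - z)"
proof -
  have "int (2 ^ w - to_word w z) = 2 ^ w - z mod 2 ^ w"
    using to_word_less[of w z] by (simp add: of_nat_diff int_to_word)
  then have "int ((to_word w y + (2 ^ w - to_word w z)) mod 2 ^ w) = (y mod 2 ^ w + (2 ^ w - z mod 2 ^ w)) mod 2 ^ w"
    by (simp add: zmod_int int_to_word)
  also have "\<dots> = (y mod 2 ^ w - z mod 2 ^ w + 2 ^ w) mod 2 ^ w"
    by (simp add: algebra_simps)
  also have "\<dots> = (y - z) mod 2 ^ w"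
    by (simp only: mod_add_self2 mod_diff_eq)
  also have "\<dots> = int (to_word w (y - z))" by (simp add: int_to_word)
  finally show ?thesis by (simp only: of_nat_eq_iff)
qed

section \<open>Predecessor search\<close>

text \<open>Three consecutive arrays. Sums of signs may be negative and are stored as residues; the
  empty prefix has a sum too, so the last array is one entry longer.\<close>

definition block :: "nat \<Rightarrow> (nat \<times> nat \<times> int) list \<Rightarrow> nat list" where
  "block w es = map fst es @ map (fst \<circ> snd) es @
     map (\<lambda>k. to_word w (\<Sum>(k, p, s)\<leftarrow>take k es. s)) [0..<Suc (length es)]"

definition sort_events :: "(nat \<times> nat \<times> int) list \<Rightarrow> (nat \<times> nat \<times> int) list" where
  "sort_events es = sort_key (\<lambda>(k, p, s). (k, p)) es"

lemma length_sort_events [simp]: "length (sort_events xs) = length xs"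
  by (simp add: sort_events_def)

text \<open>
  Registers of the binary search: 10 and 11 hold the key and the position searched for, 12 the
  address of the block, 13 the number of events, 14 and 15 the bounds of the search interval, and
  19 receives the sum of the signs of all smaller events modulo \<open>2 ^ w\<close>.
\<close>

definition search_body :: com where
  "search_body =
     Instr (Op Add 16 14 15) ;;
     Instr (Op Div 16 16 20) ;;
     Instr (Op Add 17 12 16) ;;
     Instr (Load_Stored 18 17) ;;
     Instr (Op Add 17 17 13) ;;
     Instr (Load_Stored 19 17) ;;
     Cond (Lt 18 10) (Instr (Op Add 14 16 21))
       (Cond (Eq 18 10)
         (Cond (Lt 19 11) (Instr (Op Add 14 16 21)) (Instr (Move 15 16)))
         (Instr (Move 15 16)))"

text \<open>Register 20 is both the divisor 2 and the address of the stored number of events. The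
  prefix sums start two array lengths after the start of the block.\<close>

definition search :: com where
  "search =
     Instr (Const 14 0) ;;
     Instr (Const 20 2) ;;
     Instr (Const 21 1) ;;
     Instr (Load_Stored 13 20) ;;
     Instr (Move 15 13) ;;
     While (Lt 14 15) search_body ;;
     Instr (Op Add 17 12 13) ;;
     Instr (Op Add 17 17 13) ;;
     Instr (Op Add 17 17 14) ;;
     Instr (Load_Stored 19 17)"

text \<open>All that the search needs from sortedness is the threshold \<open>c\<close>. The longest
  path takes six instructions, three tests and one assignment, hence the bound 10.\<close>

lemma wp_search_body:
  assumes "regs s 14 < regs s 15" "regs s 15 \<le> m" "regs s 13 = m" "regs s 20 = 2" "regs s 21 = 1"
    and "2 < (2::nat) ^ width E" "regs s 12 + 3 * m < 2 ^ width E"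
    and keys: "\<And>j. j < m \<Longrightarrow> (read (stored E) (regs s 12 + j), read (stored E) (regs s 12 + m + j))
      < (regs s 10, regs s 11) \<longleftrightarrow> j < c"
    and post: "\<And>t s'. t \<le> 10 \<Longrightarrow> (\<forall>r<14. regs s' r = regs s r) \<Longrightarrow> regs s' 20 = 2 \<Longrightarrow>
      regs s' 21 = 1 \<Longrightarrow>
      (let mid = (regs s 14 + regs s 15) div 2 in
        regs s' 14 = (if mid < c then mid + 1 else regs s 14) \<and>
        regs s' 15 = (if mid < c then regs s 15 else mid)) \<Longrightarrow> Q t s'"
  shows "wp E search_body Q s"
proof -
  let ?mid = "(regs s 14 + regs s 15) div 2"
  have mid: "?mid < m" using assms(1,2) by linarith
  have [simp]: "(regs s 14 + regs s 15) mod 2 ^ width E = regs s 14 + regs s 15"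
    using assms(1,2,7) by simp
  have [simp]: "(regs s 12 + ?mid) mod 2 ^ width E = regs s 12 + ?mid"
    using mid assms(7) by simp
  have [simp]: "(regs s 12 + ?mid + m) mod 2 ^ width E = regs s 12 + m + ?mid"
    using mid assms(7) by (simp add: add_ac)
  have [simp]: "Suc ?mid mod 2 ^ width E = Suc ?mid"
    using mid assms(7) by simp
  have key: "read (stored E) (regs s 12 + ?mid) < regs s 10 \<or>
      read (stored E) (regs s 12 + ?mid) = regs s 10 \<and>
      read (stored E) (regs s 12 + m + ?mid) < regs s 11 \<longleftrightarrow> ?mid < c"
    using keys[OF mid] by auto
  show ?thesis
    unfolding search_body_def using assms(3-5) key
    by (auto simp: Let_def intro!: post)
qed

text \<open>The interval keeps \<open>c\<close> between its bounds and is halved by each iteration;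
  an iteration costs at most 11 with its test.\<close>

lemma wp_search_loop:
  assumes "regs s 14 \<le> c" "c \<le> regs s 15" "regs s 15 \<le> m" "regs s 13 = m"
    and "regs s 20 = 2" "regs s 21 = 1"
    and "2 < (2::nat) ^ width E" "regs s 12 + 3 * m < 2 ^ width E"
    and "\<And>j. j < m \<Longrightarrow> (read (stored E) (regs s 12 + j), read (stored E) (regs s 12 + m + j))
      < (regs s 10, regs s 11) \<longleftrightarrow> j < c"
    and "regs s 15 - regs s 14 < 2 ^ L"
    and "\<And>t s'. t \<le> 11 * L + 1 \<Longrightarrow> (\<forall>r<14. regs s' r = regs s r) \<Longrightarrow> regs s' 14 = c \<Longrightarrow> Q t s'"
  shows "wp E (While (Lt 14 15) search_body) Q s"
  using assms
proof (induction L arbitrary: s Q)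
  case 0
  show ?case
    by (rule wp_While_False) (use 0 in auto)
next
  case (Suc L)
  show ?case
  proof (cases "regs s 14 < regs s 15")
    case False
    show ?thesis by (rule wp_While_False) (use Suc.prems False in auto)
  next
    case True
    show ?thesis
    proof (rule wp_While_True)
      show "holds (Lt 14 15) s" using True by simp
      show "wp E search_body
        (\<lambda>t. wp E (While (Lt 14 15) search_body) (\<lambda>u. Q (1 + t + u))) s"
      proof (rule wp_search_body[OF True Suc.prems(3-9)])
        fix t :: nat and s' :: state
        assume t: "t \<le> 10" and r: "\<forall>r<14. regs s' r = regs s r"
          and "regs s' 20 = 2" "regs s' 21 = 1"
          and mid: "let mid = (regs s 14 + regs s 15) div 2 in
            regs s' 14 = (if mid < c then mid + 1 else regs s 14) \<and>
            regs s' 15 = (if mid < c then regs s 15 else mid)"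
        have b: "regs s' 14 \<le> c" "c \<le> regs s' 15" "regs s' 15 \<le> m"
          "regs s' 15 - regs s' 14 < 2 ^ L"
          using mid Suc.prems(1-3,10) True by (auto simp: Let_def split: if_splits)
        show "wp E (While (Lt 14 15) search_body) (\<lambda>u. Q (1 + t + u)) s'"
        proof (rule Suc.IH)
          fix u :: nat and s'' :: state assume "u \<le> 11 * L + 1" "\<forall>r<14. regs s'' r = regs s' r" "regs s'' 14 = c"
          then show "Q (1 + t + u) s''" using t r by (intro Suc.prems(11)) auto
        qed (use b r Suc.prems \<open>regs s' 20 = 2\<close> \<open>regs s' 21 = 1\<close> in auto)
      qed auto
    qed
  qed
qed

lemma read_append:
  "read (xs @ ys) k = (if k < length xs then read xs k else read ys (k - length xs))"
  by (auto simp: read_def nth_append)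

lemma read_block:
  "j < length es \<Longrightarrow> read (block w es @ ys) j = fst (es ! j)"
  "j < length es \<Longrightarrow> read (block w es @ ys) (length es + j) = fst (snd (es ! j))"
  "j \<le> length es \<Longrightarrow> read (block w es @ ys) (length es + length es + j) =
    to_word w (\<Sum>(k, p, s)\<leftarrow>take j es. s)"
  by (auto simp: block_def read_def nth_append simp del: upt_Suc)

lemma length_block: "length (block w es) = 3 * length es + 1"
  by (simp add: block_def)

lemma sum_list_filter: "sum_list (map f (filter Q xs)) = (\<Sum>x\<leftarrow>xs. if Q x then f x else 0)"
  by (induction xs) auto

lemma sum_list_sort_key:
  fixes g :: "'b \<Rightarrow> 'c::comm_monoid_add"
  shows "sum_list (map g (sort_key f xs)) = sum_list (map g xs)"
proof -
  have "mset (map g (sort_key f xs)) = mset (map g xs)" by simp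
  then show ?thesis by (metis sum_mset_sum_list)
qed

text \<open>The smaller events are the first \<open>c\<close> sorted ones, so their signs add up to
  a stored prefix sum. Sums ignore order, which allows the result to mention the unsorted
  \<open>es\<close>.\<close>

lemma wp_search:
  assumes D: "stored E = us @ block (width E) (sort_events es) @ vs"
    and "regs s 12 = length us" "read (stored E) 2 = length es"
    and "2 < (2::nat) ^ width E" "length us + 3 * length es < 2 ^ width E" "length es < 2 ^ L"
    and post: "\<And>t s'. t \<le> 10 + 11 * L \<Longrightarrow> (\<forall>r<10. regs s' r = regs s r) \<Longrightarrow>
      regs s' 19 = to_word (width E)
        (\<Sum>(k, p, x)\<leftarrow>es. if (k, p) < (regs s 10, regs s 11) then x else 0) \<Longrightarrow> Q t s'"
  shows "wp E search Q s"
proof -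
  let ?m = "length es" and ?f = "\<lambda>(k, p, x::int). (k, p)" and ?t = "(regs s 10, regs s 11)"
  let ?es = "sort_events es"
  define c where "c = length (filter (\<lambda>e. ?f e < ?t) ?es)"
  have len: "length ?es = ?m" by simp
  have cm: "c \<le> ?m" unfolding c_def len[symmetric] by (rule length_filter_le)
  have sorted: "sorted (map ?f ?es)" by (simp add: sort_events_def)
  have rd: "read (stored E) (length us + k) = read (block (width E) ?es @ vs) k" for k
    by (simp add: D read_append)
  have key: "(read (stored E) (length us + j), read (stored E) (length us + ?m + j)) < ?t \<longleftrightarrow> j < c"
    if "j < ?m" for j
  proof -
    have "read (stored E) (length us + ?m + j) = fst (snd (?es ! j))"
      using rd[of "?m + j"] read_block(2)[of j ?es] that by (simp add: len add.assoc)
    moreover have "read (stored E) (length us + j) = fst (?es ! j)"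
      using rd[of j] read_block(1)[of j ?es] that by (simp add: len)
    moreover have "?f (?es ! j) < ?t \<longleftrightarrow> j < c"
      unfolding c_def
      by (rule sorted_nth_iff_less_length_filter[OF sorted]) (use that in \<open>auto simp: len\<close>)
    ultimately show ?thesis by (simp add: split_def)
  qed
  have tk: "take c ?es = filter (\<lambda>e. ?f e < ?t) ?es"
    unfolding c_def by (rule sorted_take_filter[OF sorted]) auto
  have "(\<Sum>(k, p, x)\<leftarrow>take c ?es. x) = (\<Sum>e\<leftarrow>?es. if ?f e < ?t then snd (snd e) else 0)"
    unfolding tk by (simp add: sum_list_filter split_def)
  also have "\<dots> = (\<Sum>e\<leftarrow>es. if ?f e < ?t then snd (snd e) else 0)"
    unfolding sort_events_def by (rule sum_list_sort_key)
  also have "\<dots> = (\<Sum>(k, p, x)\<leftarrow>es. if (k, p) < ?t then x else 0)"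
    by (simp add: split_def)
  finally have val: "read (stored E) (length us + ?m + ?m + c) =
      to_word (width E) (\<Sum>(k, p, x)\<leftarrow>es. if (k, p) < ?t then x else 0)"
    using rd[of "?m + ?m + c"] read_block(3)[of c ?es] cm by (simp add: len add.assoc)
  have [simp]: "(length us + ?m) mod 2 ^ width E = length us + ?m"
    "(length us + ?m + ?m) mod 2 ^ width E = length us + ?m + ?m"
    "(length us + ?m + ?m + c) mod 2 ^ width E = length us + ?m + ?m + c"
    using assms(5) cm by simp_all
  have [simp]: "2 mod 2 ^ width E = (2::nat)" "0 < width E"
    using assms(4) by (simp, intro gr0I, simp)
  show ?thesis
    unfolding search_def
  proof (simp add: assms(2,3), rule wp_search_loop[where c = c and m = ?m and L = L], goal_cases)
    case (9 j)
    then show ?case using key by (simp add: assms(2))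
  next
    case (11 t s')
    then have "regs s' r = regs s r" if "r < 13" for r using that by auto
    then show ?case using 11 by (simp, intro post) (simp_all add: assms(2) val)
  qed (simp_all add: assms(2-6) cm)
qed

section \<open>The relative index\<close>

text \<open>
  For the code of \<open>a\<close> in register 3 and \<open>i\<close> in register 7, the result in register 8 is
  \<open>rank a (bwt S2) i + smaller_count S2 a - smaller_count S1 a\<close> modulo \<open>2 ^ w\<close>: the second search
  also counts the events with smaller characters.
\<close>

definition rank_diff :: com where
  "rank_diff =
     Instr (Const 10 0) ;;
     Instr (Move 11 7) ;;
     Instr (Const 12 4) ;;
     search ;;
     Instr (Op Sub 9 7 19) ;;
     Instr (Query_Rank 9 3 9) ;;
     Instr (Move 10 3) ;;
     Instr (Move 11 7) ;;
     Instr (Const 12 3) ;;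
     Instr (Load_Stored 12 12) ;;
     search ;;
     Instr (Op Add 8 9 19)"

text \<open>The ranks at position 0 vanish, so the second call returns just the
  \<open>smaller_count\<close> difference, which the subtraction cancels.\<close>

definition rank_prog :: com where
  "rank_prog =
     Instr (Move 3 0) ;;
     Instr (Move 7 1) ;;
     rank_diff ;;
     Instr (Move 6 8) ;;
     Instr (Const 7 0) ;;
     rank_diff ;;
     Instr (Op Sub 0 6 8)"

definition smaller_prog :: com where
  "smaller_prog =
     Instr (Move 3 0) ;;
     Instr (Const 7 0) ;;
     rank_diff ;;
     Instr (Query_Smaller 6 3) ;;
     Instr (Op Add 0 6 8)"

text \<open>Implements \<open>row_count_prepend\<close>. Adding \<open>smaller_count S1\<close>
  cancels the term subtracted in \<open>rank_diff\<close>; the final 1 is the empty suffix.\<close>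

definition row_step :: com where
  "row_step =
     Cond (Lt 6 7) (Instr (Op Sub 7 7 4)) (Instr (Move 7 7)) ;;
     rank_diff ;;
     Instr (Query_Smaller 9 3) ;;
     Instr (Op Add 8 8 9) ;;
     Instr (Op Add 8 8 4)"

definition count_body :: com where
  "count_body =
     Instr (Op Sub 2 2 4) ;;
     Instr (Load_Pattern 3 2) ;;
     Instr (Move 7 0) ;;
     row_step ;;
     Instr (Move 0 8) ;;
     Instr (Move 7 1) ;;
     row_step ;;
     Instr (Move 1 8)"

text \<open>The search starts with the row counts 0 and \<open>length S2 + 1\<close> of the empty
  pattern; the last two commands turn row counts into ranks.\<close>

definition count_prog :: com where
  "count_prog =
     Instr (Move 2 0) ;;
     Instr (Const 4 1) ;;
     Instr (Const 5 0) ;;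
     Instr (Const 0 0) ;;
     Instr (Load_Stored 1 5) ;;
     Instr (Op Add 1 1 4) ;;
     Instr (Load_Stored 6 4) ;;
     While (Lt 5 2) count_body ;;
     Cond (Lt 0 4) (Instr (Move 0 4)) (Instr (Move 0 0)) ;;
     Instr (Op Sub 1 1 4)"

section \<open>Correctness and running time of the query programs\<close>

lemma apply_op_decrement: "0 < x \<Longrightarrow> x < 2 ^ w \<Longrightarrow> apply_op w Sub x (Suc 0) = x - 1"
proof -
  assume x: "0 < x" "x < 2 ^ w"
  then have eq: "x + (2 ^ w - Suc 0) = x - 1 + 2 ^ w" by simp
  show ?thesis unfolding apply_op.simps eq mod_add_self2 using x by simp
qed

lemma rank_le_length: "rank a X i \<le> length X"
  unfolding rank_def using count_le_length[of "take i X" a] by simp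

lemma smaller_count_le: "smaller_count S a \<le> length S"
  by (simp add: smaller_count_eq_filter)

locale relative_index =
  fixes A :: "'a::linorder set" and code :: "'a \<Rightarrow> nat" and w :: nat
    and S1 S2 :: "'a list" and I :: fm_index and es :: "'a edit list"
  assumes S1: "set S1 \<subseteq> A" and S2: "set S2 \<subseteq> A"
    and mono: "strict_mono_on A code" and code_less: "\<forall>a\<in>A. code a < 2 ^ w"
    and wide: "100 * (length S1 + length S2 + 1) \<le> 2 ^ w"
    and fm: "is_fm_index A code S1 I"
    and source: "source es = bwt S1" and target: "target es = bwt S2"
    and length_evs: "length (events 0 es) = BWD S1 S2"
begin

text \<open>The constant key 0 makes the common search routine compare by position alone.\<close>

definition pos_events :: "(nat \<times> nat \<times> int) list" where
  "pos_events = map (\<lambda>(p, c, s). (0, p, s)) (events 0 es)"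

definition char_events :: "(nat \<times> nat \<times> int) list" where
  "char_events = map (\<lambda>(p, c, s). (code c, p, s)) (events 0 es)"

text \<open>The fourth word is the address of the second block: four header words plus a first block
  of \<open>3 * BWD S1 S2 + 1\<close> words.\<close>

definition data :: "nat list" where
  "data = [length S2, text_row S2, BWD S1 S2, 3 * BWD S1 S2 + 5] @
     block w (sort_events pos_events) @ block w (sort_events char_events)"

definition env_ok :: "env \<Rightarrow> bool" where
  "env_ok E \<longleftrightarrow> width E = w \<and> index E = I \<and> stored E = data"

lemma length_events_eq [simp]: "length pos_events = BWD S1 S2" "length char_events = BWD S1 S2"
  by (simp_all add: pos_events_def char_events_def length_evs)

lemma BWD_le: "BWD S1 S2 \<le> length S1 + length S2"
  by (simp add: BWD_def)

lemma read_data: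
  "read data 0 = length S2" "read data (Suc 0) = text_row S2" "read data 2 = BWD S1 S2"
  "read data 3 = 3 * BWD S1 S2 + 5"
  by (simp_all add: data_def read_def)

lemma length_data: "length data = 6 * BWD S1 S2 + 6"
  by (simp add: data_def length_block)

lemma event_bounds:
  assumes "(p, c, x) \<in> set (events 0 es)"
  shows "p \<le> length S2" and "c \<in> A"
  using events_bounds[OF assms] S1 S2 by (auto simp: source target length_bwt set_bwt)

lemma data_less: "x \<in> set data \<Longrightarrow> x < 2 ^ w"
proof -
  have n: "length S2 < 2 ^ w" "3 * BWD S1 S2 + 5 < 2 ^ w" "text_row S2 < 2 ^ w"
    using wide BWD_le row_count_le[of S2] unfolding text_row_def by (force intro: le_less_trans)+
  have block: "x < 2 ^ w" if "x \<in> set (block w (sort_events xs))"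
    "\<And>k p s. (k, p, s) \<in> set xs \<Longrightarrow> k < 2 ^ w \<and> p < 2 ^ w" for xs x
  proof -
    have "set (sort_events xs) = set xs" by (simp add: sort_events_def)
    then show ?thesis using that to_word_less[of w] by (fastforce simp: block_def)
  qed
  assume "x \<in> set data"
  then consider "x \<in> {length S2, text_row S2, BWD S1 S2, 3 * BWD S1 S2 + 5}"
    | "x \<in> set (block w (sort_events pos_events))" | "x \<in> set (block w (sort_events char_events))"
    by (auto simp: data_def)
  then show ?thesis
  proof cases
    case 1
    then show ?thesis using n by auto
  next
    case 2
    show ?thesis
      by (rule block[OF 2]) (use event_bounds n(1) in \<open>fastforce simp: pos_events_def\<close>)
  next
    case 3
    show ?thesis
      by (rule block[OF 3]) (use event_bounds n(1) code_less in \<open>fastforce simp: char_events_def\<close>)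
  qed
qed

lemma sum_pos_events:
  "(\<Sum>(k, p, x)\<leftarrow>pos_events. if (k, p) < (0, i) then x else 0)
    = balance (\<lambda>p _. p < i) (events 0 es)"
  by (simp add: pos_events_def balance_def split_def o_def cong: if_cong)

text \<open>As \<open>code\<close> preserves the order, the smaller pairs split into events with
  smaller characters, whose signs give the \<open>smaller_count\<close> difference, and events with
  character \<open>a\<close> before \<open>i\<close>.\<close>

lemma sum_char_events:
  assumes "a \<in> A" and "i \<le> length S2"
  shows "(\<Sum>(k, p, x)\<leftarrow>char_events. if (k, p) < (code a, i) then x else 0)
    = int (smaller_count S2 a) - int (smaller_count S1 a)
      + balance (\<lambda>p c. c = a \<and> p < i) (events 0 es)"
proof -
  have "(\<Sum>(k, p, x)\<leftarrow>char_events. if (k, p) < (code a, i) then x else 0)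
      = balance (\<lambda>p c. (code c, p) < (code a, i)) (events 0 es)"
    by (simp add: char_events_def balance_def split_def o_def cong: if_cong)
  also have "\<dots> = balance (\<lambda>p c. c < a \<or> c = a \<and> p < i) (events 0 es)"
  proof (rule balance_cong)
    fix p c s assume "(p, c, s) \<in> set (events 0 es)"
    then have "c \<in> A" by (rule event_bounds)
    then have "code c < code a \<longleftrightarrow> c < a" "code c = code a \<longleftrightarrow> c = a"
      using mono assms(1) strict_mono_on_less[OF mono] strict_mono_on_eqD[OF mono] by auto
    then show "(code c, p) < (code a, i) \<longleftrightarrow> c < a \<or> c = a \<and> p < i" by auto
  qed
  also have "\<dots> = balance (\<lambda>_ c. c < a) (events 0 es)
      + balance (\<lambda>p c. c = a \<and> p < i) (events 0 es)"
    unfolding balance_def sum_list_addf[symmetric]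
    by (rule arg_cong[where f = sum_list], rule map_cong) auto
  also have "balance (\<lambda>_ c. c < a) (events 0 es) = int (smaller_count S2 a) - int (smaller_count S1 a)"
    using balance_total[of "\<lambda>c. c < a" es 0] by (simp add: source target smaller_count_bwt)
  finally show ?thesis .
qed

text \<open>\<open>rank_target\<close> reduces the rank to a query on \<open>S1\<close> at
  \<open>i - d\<close> plus a correction. The time is two searches, the rank query and ten further
  units.\<close>

lemma wp_rank_diff:
  assumes E: "env_ok E" and L: "BWD S1 S2 < 2 ^ L"
    and a: "a \<in> A" "regs s 3 = code a" and i: "regs s 7 = i" "i \<le> length S2"
    and post: "\<And>t s'. t \<le> 30 + 22 * L + rank_time I \<Longrightarrow> (\<forall>r<8. regs s' r = regs s r) \<Longrightarrow>
      regs s' 8 = to_word w (int (rank a (bwt S2) i) + int (smaller_count S2 a)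
        - int (smaller_count S1 a)) \<Longrightarrow> Q t s'"
  shows "wp E rank_diff Q s"
proof -
  define d where "d = balance (\<lambda>p _. p < i) (events 0 es)"
  define b where "b = balance (\<lambda>p c. c = a \<and> p < i) (events 0 es)"
  have W: "width E = w" "index E = I" "stored E = data" using E by (simp_all add: env_ok_def)
  have big: "n < 2 ^ w" if "n < 100 * (length S1 + length S2 + 1)" for n
    using that wide by (rule less_le_trans)
  have rt: "0 \<le> int i - d" "int i - d \<le> int (length S1)"
    "int (rank a (bwt S2) i) = int (rank a (bwt S1) (nat (int i - d))) + b"
    using rank_target[of i es 0 a] i(2) by (simp_all add: d_def b_def source target length_bwt)
  have nd: "nat (int i - d) \<le> length S1" using rt by simp
  have nd': "to_word w (int i - d) = nat (int i - d)"
    using to_word_int[of "nat (int i - d)" w] rt nd big[of "nat (int i - d)"] by simp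
  have i': "i = to_word w (int i)"
    using big[of i] i(2) by (simp add: to_word_int)
  \<comment> \<open>Although \<open>d\<close> may be negative, \<open>i - d\<close> lies between 0
    and \<open>length S1\<close>, so wrapped subtraction yields the true query position.\<close>
  have sub: "(i + (2 ^ w - to_word w d)) mod 2 ^ w = nat (int i - d)"
    using diff_to_word[of w "int i" d] i' nd' by simp
  have rk: "fm_rank I (code a) (nat (int i - d)) = rank a (bwt S1) (nat (int i - d))"
    using fm a(1) nd by (simp add: is_fm_index_def)
  have rkm: "rank a (bwt S1) (nat (int i - d)) < 2 ^ w"
    using rank_le_length[of a "bwt S1" "nat (int i - d)"] by (intro big) (simp add: length_bwt)
  have [simp]: "4 mod 2 ^ w = (4::nat)" "3 mod 2 ^ w = (3::nat)"
    using big[of 4] big[of 3] by simp_all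
  have two: "2 < (2::nat) ^ width E" using big[of 2] W by simp
  have m: "4 + 3 * BWD S1 S2 < 2 ^ w" "3 * BWD S1 S2 + 5 + 3 * BWD S1 S2 < 2 ^ w"
    using BWD_le by (auto intro!: big)
  have D1: "stored E = [length S2, text_row S2, BWD S1 S2, 3 * BWD S1 S2 + 5] @
     block (width E) (sort_events pos_events) @ block w (sort_events char_events)"
    by (simp add: W data_def)
  have D2: "stored E = ([length S2, text_row S2, BWD S1 S2, 3 * BWD S1 S2 + 5] @
     block w (sort_events pos_events)) @ block (width E) (sort_events char_events) @ []"
    by (simp add: W data_def)
  show ?thesis
    unfolding rank_diff_def
  proof (simp add: W, rule wp_search[OF D1, where L = L], goal_cases)
    case (6 t s')
    have regs: "regs s' r = regs s r" if "r < 10" for r using 6(2) that by simp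
    have d: "regs s' 19 = to_word w d"
      using 6(3) sum_pos_events[of i] by (simp add: W i d_def)
    show ?case
    proof (simp add: W regs d a i sub rk rkm read_data, rule wp_search[OF D2, where L = L], goal_cases)
      case (6 u s'')
      have regs': "regs s'' r = regs s r" if "r < 9" for r using 6(2) that regs by simp
      have v: "regs s'' 19 = to_word w (int (smaller_count S2 a) - int (smaller_count S1 a) + b)"
        using 6(3) sum_char_events[OF a(1) i(2)] by (simp add: W b_def)
      have "regs s'' 9 = to_word w (int (rank a (bwt S1) (nat (int i - d))))"
        using 6(2) rkm by (simp add: to_word_int)
      then have "(regs s'' 9 + regs s'' 19) mod 2 ^ w =
          to_word w (int (rank a (bwt S2) i) + int (smaller_count S2 a) - int (smaller_count S1 a))"
        unfolding v by (simp add: add_to_word rt(3) algebra_simps)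
      then show ?case
        using 6(1) \<open>t \<le> 10 + 11 * L\<close> regs' by (simp add: W, intro post) simp_all
    qed (use two L m in \<open>simp_all add: W read_data length_block\<close>)
  qed (use two L m in \<open>simp_all add: W read_data\<close>)
qed

lemma rank_prog_correct:
  assumes E: "env_ok E" and a: "a \<in> A" and i: "i \<le> length S2"
  shows "wp E rank_prog (\<lambda>t s. regs s 0 = rank a (bwt S2) i) (init [code a, i])"
proof -
  obtain L where L: "BWD S1 S2 < 2 ^ L" using less_exp by blast
  have W: "width E = w" using E by (simp add: env_ok_def)
  have "rank a (bwt S2) i < 2 ^ w"
    using rank_le_length[of a "bwt S2" i] wide by (simp add: length_bwt)
  then have r: "to_word w (int (rank a (bwt S2) i)) = rank a (bwt S2) i" by (rule to_word_int)
  have [simp]: "regs (init [code a, i]) 0 = code a" "regs (init [code a, i]) (Suc 0) = i"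
    by (simp_all add: init_def read_def)
  show ?thesis
    unfolding rank_prog_def
  proof (simp, rule wp_rank_diff[OF E L a, where i = i], goal_cases)
    case (4 t s)
    show ?case
    proof (simp, rule wp_rank_diff[OF E L a, where i = 0], goal_cases)
      case (4 u s')
      have "rank a (bwt S2) 0 = 0" by (simp add: rank_def)
      then show ?case using 4(2,3) \<open>regs s 8 = _\<close> by (simp add: W diff_to_word r)
    qed (use 4 in \<open>simp_all\<close>)
  qed (simp_all add: i)
qed

lemma smaller_query:
  assumes "a \<in> A"
  shows "fm_smaller I (code a) mod 2 ^ w = to_word w (int (smaller_count S1 a))"
proof -
  have "smaller_count S1 a < 2 ^ w" using smaller_count_le[of S1 a] wide by simp
  then show ?thesis using fm assms by (simp add: is_fm_index_def to_word_int)
qed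

lemma smaller_prog_correct:
  assumes E: "env_ok E" and a: "a \<in> A"
  shows "wp E smaller_prog (\<lambda>t s. regs s 0 = smaller_count S2 a) (init [code a])"
proof -
  obtain L where L: "BWD S1 S2 < 2 ^ L" using less_exp by blast
  have W: "width E = w" "index E = I" using E by (simp_all add: env_ok_def)
  have "smaller_count S2 a < 2 ^ w" using smaller_count_le[of S2 a] wide by simp
  then have r: "to_word w (int (smaller_count S2 a)) = smaller_count S2 a" by (rule to_word_int)
  have [simp]: "regs (init [code a]) 0 = code a"
    by (simp add: init_def read_def)
  show ?thesis
    unfolding smaller_prog_def
  proof (simp, rule wp_rank_diff[OF E L a, where i = 0], goal_cases)
    case (4 t s)
    have "rank a (bwt S2) 0 = 0" by (simp add: rank_def)
    then show ?case using 4(2,3) by (simp add: W smaller_query a add_to_word r)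
  qed simp_all
qed

lemma wp_row_step:
  assumes E: "env_ok E" and L: "BWD S1 S2 < 2 ^ L"
    and a: "a \<in> A" "regs s 3 = code a"
    and U: "\<And>x y. x \<le> y \<Longrightarrow> U y \<Longrightarrow> U x" "regs s 7 = row_count S2 U"
    and "regs s 4 = 1" "regs s 6 = text_row S2"
    and post: "\<And>t s'. t \<le> 35 + 22 * L + rank_time I + smaller_time I \<Longrightarrow>
      (\<forall>r<7. regs s' r = regs s r) \<Longrightarrow> regs s' 8 = row_count S2 (prepend_set a U) \<Longrightarrow> Q t s'"
  shows "wp E row_step Q s"
proof -
  define i where "i = (if text_row S2 < row_count S2 U then row_count S2 U - 1 else row_count S2 U)"
  have W: "width E = w" "index E = I" using E by (simp_all add: env_ok_def)
  have "card {i. i < length S2 \<and> U (drop (Suc i) S2)} \<le> card {..<length S2}"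
    by (rule card_mono) auto
  then have i: "i \<le> length S2"
    using row_count_skip_text[of U S2, OF U(1)] by (simp add: i_def)
  have step: "row_count S2 (prepend_set a U) = 1 + smaller_count S2 a + rank a (bwt S2) i"
    unfolding i_def by (rule row_count_prepend[of U, OF U(1)])
  have less: "row_count S2 V < 2 ^ w" for V
    using row_count_le[of S2 V] wide by simp
  have one: "1 = to_word w (int 1)" using wide by (intro to_word_int[symmetric]) simp
  \<comment> \<open>Both branches of the conditional leave \<open>i\<close> in register 7 after two
    units, so the remaining program is treated once.\<close>
  have rest: "wp E (rank_diff ;; Instr (Query_Smaller 9 3) ;; Instr (Op Add 8 8 9) ;;
      Instr (Op Add 8 8 4)) (\<lambda>u. Q (2 + u)) s'"
    if s': "regs s' 7 = i" "\<forall>r<7. regs s' r = regs s r" for s'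
  proof (simp, rule wp_rank_diff[OF E L a(1) _ s'(1) i], goal_cases)
    case (2 t s'')
    have regs: "regs s'' r = regs s r" if "r < 7" for r using 2(2) s'(2) that by simp
    have "((regs s'' 8 + to_word w (int (smaller_count S1 a))) mod 2 ^ w + 1) mod 2 ^ w =
        to_word w (int (row_count S2 (prepend_set a U)))"
      unfolding 2(3) by (subst one) (simp add: add_to_word step algebra_simps)
    also have "\<dots> = row_count S2 (prepend_set a U)" by (rule to_word_int[OF less])
    finally show ?case
      using 2(1) regs by (simp add: W a smaller_query assms(7), intro post) simp_all
  qed (use s' a in simp)
  show ?thesis
  proof (cases "text_row S2 < row_count S2 U")
    case True
    then show ?thesis
      unfolding row_step_def wp_Seq[of E "Cond _ _ _"] wp_Cond wp_Instr
      using rest[of "set_reg s 7 i"] assms(6-8) less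
      by (simp add: W i_def apply_op_decrement del: apply_op.simps(2))
  next
    case False
    then show ?thesis
      unfolding row_step_def wp_Seq[of E "Cond _ _ _"] wp_Cond wp_Instr
      using rest[of "set_reg s 7 i"] assms(6-8) by (simp add: W i_def)
  qed
qed

text \<open>The invariant keeps both boundaries for the processed part \<open>drop j P\<close>;
  \<open>below_Cons\<close> and \<open>upto_prefixed_Cons\<close> extend it by one character. An
  iteration is two row steps plus seven units, including the test.\<close>

lemma wp_count_loop:
  assumes E: "env_ok E" and L: "BWD S1 S2 < 2 ^ L"
    and P: "pattern E = map code P" "set P \<subseteq> A" "length P < 2 ^ w"
    and "j \<le> length P" "regs s 2 = j"
    and "regs s 0 = row_count S2 (below (drop j P))"
    and "regs s 1 = row_count S2 (upto_prefixed (drop j P))"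
    and "regs s 4 = 1" "regs s 5 = 0" "regs s 6 = text_row S2"
    and "\<And>t s'. t \<le> 1 + j * (77 + 44 * L + 2 * rank_time I + 2 * smaller_time I) \<Longrightarrow>
      regs s' 4 = 1 \<Longrightarrow> regs s' 0 = row_count S2 (below P) \<Longrightarrow>
      regs s' 1 = row_count S2 (upto_prefixed P) \<Longrightarrow> Q t s'"
  shows "wp E (While (Lt 5 2) count_body) Q s"
  using assms(6-)
proof (induction j arbitrary: s Q)
  case 0
  show ?case by (rule wp_While_False) (use 0 in auto)
next
  case (Suc j)
  let ?a = "P ! j"
  have W: "width E = w" using E by (simp add: env_ok_def)
  have j: "j < length P" using Suc.prems(1) by simp
  then have a: "?a \<in> A" using P(2) by auto
  have drop: "drop j P = ?a # drop (Suc j) P" using Cons_nth_drop_Suc[OF j] by simp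
  have [simp]: "apply_op w Sub (Suc j) (Suc 0) = j"
    using apply_op_decrement[of "Suc j" w] j P(3) by simp
  have [simp]: "read (map code P) j = code ?a" using j by (simp add: read_def)
  show ?case
  proof (rule wp_While_True)
    show "holds (Lt 5 2) s" using Suc.prems by simp
    show "wp E count_body (\<lambda>t. wp E (While (Lt 5 2) count_body) (\<lambda>u. Q (1 + t + u))) s"
      unfolding count_body_def wp_Seq wp_Instr
    proof (rule wp_row_step[OF E L a, where U = "below (drop (Suc j) P)"], goal_cases)
      case (6 t s1)
      show ?case
        unfolding wp_Seq wp_Instr
      proof (rule wp_row_step[OF E L a, where U = "upto_prefixed (drop (Suc j) P)"], goal_cases)
        case (6 u s2)
        show ?case
          unfolding wp_Seq wp_Instr count_body_def[symmetric]
        proof (rule Suc.IH, goal_cases)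
          case (8 v s3)
          show ?case
            by (rule Suc.prems(8)) (use 8 \<open>t \<le> _\<close> \<open>u \<le> _\<close> in simp_all)
        qed (use 6(2,3) \<open>\<forall>r<7. regs s1 r = _\<close> \<open>regs s1 8 = _\<close> Suc.prems drop in
            \<open>simp_all add: below_Cons upto_prefixed_Cons W P del: apply_op.simps(2)\<close>)
      qed (use 6 Suc.prems upto_prefixed_down in \<open>auto simp: W P simp del: apply_op.simps(2)\<close>)
    qed (use Suc.prems below_down in \<open>auto simp: W P simp del: apply_op.simps(2)\<close>)
  qed
qed

lemma count_prog_correct:
  assumes E: "env_ok E" and L: "BWD S1 S2 < 2 ^ L"
    and P: "pattern E = map code P" "set P \<subseteq> A" "length P < 2 ^ w"
  shows "wp E count_prog (\<lambda>t s.
    t \<le> 11 + length P * (77 + 44 * L + 2 * rank_time I + 2 * smaller_time I) \<and>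
    is_suffix_range S2 P (regs s 0) (regs s 1) \<and>
    regs s 1 + 1 - regs s 0 = occurrences P S2) (init [length P])"
proof -
  have W: "width E = w" "stored E = data" using E by (simp_all add: env_ok_def)
  have [simp]: "regs (init [length P]) 0 = length P" by (simp add: init_def read_def)
  have "(1::nat) < 2 ^ w" using wide by simp
  then have [simp]: "0 < w" by (intro gr0I) simp
  have [simp]: "Suc (length S2) mod 2 ^ w = Suc (length S2)" using wide by simp
  let ?h = "row_count S2 (upto_prefixed P)"
  have h: "1 \<le> ?h" by (rule suffix_range_row_counts)
  have sub: "apply_op w Sub ?h (Suc 0) = ?h - 1"
    using h row_count_le[of S2 "upto_prefixed P"] wide by (intro apply_op_decrement) simp_all
  note range = suffix_range_row_counts(1,2)[of S2 P]
  show ?thesis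
    unfolding count_prog_def
  proof (simp add: W read_data, rule wp_count_loop[OF E L P, where j = "length P"], goal_cases)
    case (8 t s)
    then show ?case using range by (auto simp: W sub simp del: apply_op.simps(2))
  qed simp_all
qed

end

section \<open>Running time of backward search on the given index\<close>

lemma wp_backward_loop:
  fixes E :: env
  defines "T \<equiv> 10 + 2 * rank_time (index E) + smaller_time (index E)"
  assumes "regs s 2 = j" "j < 2 ^ width E" "regs s 4 = 1" "regs s 5 = 0"
    and "\<And>s'. Q (1 + j * T) s'"
  shows "wp E (While (Lt 5 2)
       (Instr (Op Sub 2 2 4) ;;
        Instr (Load_Pattern 3 2) ;;
        Instr (Query_Smaller 6 3) ;;
        Instr (Op Sub 0 0 4) ;;
        Instr (Query_Rank 0 3 0) ;;
        Instr (Op Add 0 0 4) ;;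
        Instr (Op Add 0 0 6) ;;
        Instr (Query_Rank 1 3 1) ;;
        Instr (Op Add 1 1 6))) Q s"
  using assms(2-)
proof (induction j arbitrary: s Q)
  case 0
  show ?case by (rule wp_While_False) (use 0 in auto)
next
  case (Suc j)
  have [simp]: "apply_op (width E) Sub (Suc j) (Suc 0) = j"
    using apply_op_decrement[of "Suc j" "width E"] Suc.prems by simp
  show ?case
  proof (rule wp_While_True)
    show "holds (Lt 5 2) s" using Suc.prems by simp
  next
    show "wp E (Instr (Op Sub 2 2 4) ;;
        Instr (Load_Pattern 3 2) ;;
        Instr (Query_Smaller 6 3) ;;
        Instr (Op Sub 0 0 4) ;;
        Instr (Query_Rank 0 3 0) ;;
        Instr (Op Add 0 0 4) ;;
        Instr (Op Add 0 0 6) ;;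
        Instr (Query_Rank 1 3 1) ;;
        Instr (Op Add 1 1 6)) (\<lambda>t. wp E (While (Lt 5 2)
       (Instr (Op Sub 2 2 4) ;;
        Instr (Load_Pattern 3 2) ;;
        Instr (Query_Smaller 6 3) ;;
        Instr (Op Sub 0 0 4) ;;
        Instr (Query_Rank 0 3 0) ;;
        Instr (Op Add 0 0 4) ;;
        Instr (Op Add 0 0 6) ;;
        Instr (Query_Rank 1 3 1) ;;
        Instr (Op Add 1 1 6))) (\<lambda>u. Q (1 + t + u))) s"
      unfolding wp_Seq wp_Instr
    proof (rule Suc.IH, goal_cases)
      case (5 s')
      show ?case
        by (rule back_subst[where P = "\<lambda>t. Q t s'", OF Suc.prems(5)]) (simp add: T_def)
    qed (use Suc.prems in \<open>simp_all del: apply_op.simps(2)\<close>)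
  qed
qed

text \<open>This is the yardstick for the slowdown, so only time is tracked. The 6 consists of five
  initial instructions and the failing test.\<close>

lemma wp_backward_search:
  assumes "m < 2 ^ width E" "1 < (2::nat) ^ width E"
  shows "wp E backward_search
    (\<lambda>t s. t = 6 + m * (10 + 2 * rank_time (index E) + smaller_time (index E))) (init [m])"
proof -
  have "0 < width E" using assms(2) by (intro gr0I) simp
  then show ?thesis
    unfolding backward_search_def wp_Seq wp_Instr
    by (intro wp_backward_loop[where j = m])
       (use assms in \<open>simp_all add: init_def read_def\<close>)
qed

text \<open>The hypothesis on \<open>L\<close> gives \<open>L\<close> at most one plus the
  logarithm. The logarithm is at least 1, as its argument is at least 2, so it also absorbs all
  additive constants.\<close>

lemma log_time_bound:
  fixes m p R Q L t :: nat
  assumes "2 ^ L \<le> 2 * (m + 1)" and "t \<le> 11 + p * (77 + 44 * L + 2 * R + 2 * Q)"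
  shows "real t \<le> 100 * log 2 (real m + 2) * real (6 + p * (10 + 2 * R + Q))"
proof -
  let ?l = "log 2 (real m + 2)"
  have l1: "1 \<le> ?l" by (subst le_log_iff) auto
  have "real (2 ^ L) \<le> real (2 * (m + 1))" using assms(1) by (simp only: of_nat_le_iff)
  then have "2 powr real L \<le> 2 * (real m + 2)" by (simp add: powr_realpow)
  then have "real L \<le> log 2 (2 * (real m + 2))" by (subst le_log_iff) auto
  also have "\<dots> = 1 + ?l" by (subst log_mult) auto
  finally have L: "real L \<le> 2 * ?l" using l1 by linarith
  have "real t \<le> real (11 + p * (77 + 44 * L + 2 * R + 2 * Q))"
    using assms(2) by (simp only: of_nat_le_iff)
  also have "\<dots> = 11 + p * (77 + 44 * real L + 2 * R + 2 * Q)" by simp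
  also have "\<dots> \<le> ?l * 600 + p * (?l * (100 * (10 + 2 * R + Q)))"
  proof (intro add_mono mult_left_mono)
    have "77 + 2 * real R + 2 * real Q \<le> ?l * (77 + 2 * real R + 2 * real Q)"
      using mult_right_mono[OF l1, of "77 + 2 * real R + 2 * real Q"] by simp
    then have "77 + 44 * real L + 2 * R + 2 * Q \<le> ?l * (165 + 2 * real R + 2 * real Q)"
      using L by (simp add: algebra_simps)
    also have "\<dots> \<le> ?l * (100 * (10 + 2 * R + Q))"
      using l1 by (intro mult_left_mono) auto
    finally show "77 + 44 * real L + 2 * R + 2 * Q \<le> ?l * (100 * (10 + 2 * R + Q))" .
  qed (use l1 in linarith, simp)
  also have "\<dots> = 100 * ?l * real (6 + p * (10 + 2 * R + Q))" by (simp add: algebra_simps)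
  finally show ?thesis .
qed

theorem theorem1:
  "\<exists>(K :: nat) (rank_prog :: com) (smaller_prog :: com) (count_prog :: com).
     \<forall>(A :: 'a::linorder set) (code :: 'a \<Rightarrow> nat) (w :: nat)
       (S1 :: 'a list) (S2 :: 'a list) (I :: fm_index).
       set S1 \<subseteq> A \<longrightarrow> set S2 \<subseteq> A \<longrightarrow>
       strict_mono_on A code \<longrightarrow> (\<forall>a\<in>A. code a < 2 ^ w) \<longrightarrow>
       K * (length S1 + length S2 + 1) \<le> 2 ^ w \<longrightarrow>
       is_fm_index A code S1 I \<longrightarrow>
       (\<exists>D :: nat list.
          (\<forall>x\<in>set D. x < 2 ^ w) \<and>
          length D \<le> K * (BWD S1 S2 + 1) \<and>
          (\<forall>a\<in>A. \<forall>i\<le>length S2. \<exists>t s.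
             exec \<lparr>width = w, index = I, stored = D, pattern = []\<rparr> rank_prog (init [code a, i]) t s \<and>
             regs s 0 = rank a (bwt S2) i) \<and>
          (\<forall>a\<in>A. \<exists>t s.
             exec \<lparr>width = w, index = I, stored = D, pattern = []\<rparr> smaller_prog (init [code a]) t s \<and>
             regs s 0 = smaller_count S2 a) \<and>
          (\<forall>P. set P \<subseteq> A \<longrightarrow> length P < 2 ^ w \<longrightarrow>
             (\<exists>t1 s1 t2 s2.
                exec \<lparr>width = w, index = I, stored = [length S1], pattern = map code P\<rparr>
                  backward_search (init [length P]) t1 s1 \<and>
                exec \<lparr>width = w, index = I, stored = D, pattern = map code P\<rparr>
                  count_prog (init [length P]) t2 s2 \<and>
                is_suffix_range S2 P (regs s2 0) (regs s2 1) \<and>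
                regs s2 1 + 1 - regs s2 0 = occurrences P S2 \<and>
                real t2 \<le> real K * log 2 (real (BWD S1 S2) + 2) * real t1)))"
\<comment> \<open>The constant 100 serves as bound for the word size, the space and the time factor
  alike.\<close>
proof (rule exI[of _ "100::nat"], rule exI[of _ rank_prog], rule exI[of _ smaller_prog],
    rule exI[of _ count_prog], intro allI impI)
  fix A :: "'a set" and code :: "'a \<Rightarrow> nat" and w :: nat and S1 S2 :: "'a list" and I :: fm_index
  assume A: "set S1 \<subseteq> A" "set S2 \<subseteq> A" "strict_mono_on A code" "\<forall>a\<in>A. code a < 2 ^ w"
    "100 * (length S1 + length S2 + 1) \<le> 2 ^ w" "is_fm_index A code S1 I"
  obtain es where es: "source es = bwt S1" "target es = bwt S2" "length (events 0 es) = BWD S1 S2"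
    using BWD_edit_script by blast
  interpret relative_index A code w S1 S2 I es
    using A es by unfold_locales
  let ?E = "\<lambda>P. \<lparr>width = w, index = I, stored = data, pattern = map code P\<rparr>"
  let ?F = "\<lambda>P. \<lparr>width = w, index = I, stored = [length S1], pattern = map code P\<rparr>"
  \<comment> \<open>\<open>env_ok\<close> does not restrict the pattern, so \<open>P = []\<close>
    covers the rank and smaller queries.\<close>
  have ok: "env_ok (?E P)" for P by (simp add: env_ok_def)
  \<comment> \<open>The exponent \<open>Suc n\<close> is large enough for the binary search and
    small enough for the logarithmic bound.\<close>
  obtain n where n: "2 ^ n \<le> BWD S1 S2 + 1" "BWD S1 S2 + 1 < 2 ^ (n + 1)"
    using ex_power_ivl1[of 2 "BWD S1 S2 + 1"] by auto
  have L: "BWD S1 S2 < 2 ^ Suc n" "2 ^ Suc n \<le> 2 * (BWD S1 S2 + 1)" using n by auto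
  have one: "(1::nat) < 2 ^ w" using A(5) by simp
  show "\<exists>D. (\<forall>x\<in>set D. x < 2 ^ w) \<and>
          length D \<le> 100 * (BWD S1 S2 + 1) \<and>
          (\<forall>a\<in>A. \<forall>i\<le>length S2. \<exists>t s.
             exec \<lparr>width = w, index = I, stored = D, pattern = []\<rparr> rank_prog (init [code a, i]) t s \<and>
             regs s 0 = rank a (bwt S2) i) \<and>
          (\<forall>a\<in>A. \<exists>t s.
             exec \<lparr>width = w, index = I, stored = D, pattern = []\<rparr> smaller_prog (init [code a]) t s \<and>
             regs s 0 = smaller_count S2 a) \<and>
          (\<forall>P. set P \<subseteq> A \<longrightarrow> length P < 2 ^ w \<longrightarrow>
             (\<exists>t1 s1 t2 s2.
                exec \<lparr>width = w, index = I, stored = [length S1], pattern = map code P\<rparr>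
                  backward_search (init [length P]) t1 s1 \<and>
                exec \<lparr>width = w, index = I, stored = D, pattern = map code P\<rparr>
                  count_prog (init [length P]) t2 s2 \<and>
                is_suffix_range S2 P (regs s2 0) (regs s2 1) \<and>
                regs s2 1 + 1 - regs s2 0 = occurrences P S2 \<and>
                real t2 \<le> real 100 * log 2 (real (BWD S1 S2) + 2) * real t1))"
  proof (intro exI[of _ data] conjI ballI allI impI)
    fix a i assume "a \<in> A" "i \<le> length S2"
    from rank_prog_correct[OF ok[of "[]"] this]
    show "\<exists>t s. exec \<lparr>width = w, index = I, stored = data, pattern = []\<rparr> rank_prog (init [code a, i]) t s \<and>
      regs s 0 = rank a (bwt S2) i" by (simp add: wp_def)
  next
    fix a assume "a \<in> A"
    from smaller_prog_correct[OF ok[of "[]"] this]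
    show "\<exists>t s. exec \<lparr>width = w, index = I, stored = data, pattern = []\<rparr> smaller_prog (init [code a]) t s \<and>
      regs s 0 = smaller_count S2 a" by (simp add: wp_def)
  next
    fix P assume P: "set P \<subseteq> A" "length P < 2 ^ w"
    obtain t1 s1 where 1: "exec (?F P) backward_search (init [length P]) t1 s1"
      "t1 = 6 + length P * (10 + 2 * rank_time I + smaller_time I)"
      using wp_backward_search[of "length P" "?F P"] P(2) one by (auto simp: wp_def)
    obtain t2 s2 where 2: "exec (?E P) count_prog (init [length P]) t2 s2"
      "t2 \<le> 11 + length P * (77 + 44 * Suc n + 2 * rank_time I + 2 * smaller_time I)"
      "is_suffix_range S2 P (regs s2 0) (regs s2 1)"
      "regs s2 1 + 1 - regs s2 0 = occurrences P S2"
      using count_prog_correct[OF ok[of P] L(1) _ P] unfolding wp_def env.simps by blast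
    have "real t2 \<le> real 100 * log 2 (real (BWD S1 S2) + 2) * real t1"
      using log_time_bound[OF L(2) 2(2)] by (simp add: 1(2))
    with 1(1) 2 show "\<exists>t1 s1 t2 s2. exec (?F P) backward_search (init [length P]) t1 s1 \<and>
      exec (?E P) count_prog (init [length P]) t2 s2 \<and>
      is_suffix_range S2 P (regs s2 0) (regs s2 1) \<and>
      regs s2 1 + 1 - regs s2 0 = occurrences P S2 \<and>
      real t2 \<le> real 100 * log 2 (real (BWD S1 S2) + 2) * real t1" by blast
  qed (use data_less in \<open>auto simp: length_data\<close>)
qed

end
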